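(* The difference operators $\widetilde{\mathcal H}_T,\widetilde{\mathcal H}_0,\widetilde{\mathcal H}_1,\ldots,\widetilde{\mathcal H}_{n-1}$ commute with each other: $$[\widetilde{\mathcal H}_T,\widetilde{\mathcal H}_j]=0,\qquad[\widetilde{\mathcal H}_j,\widetilde{\mathcal H}_k]=0,\qquad j,k=0,1,\ldots,n-1.$$
   Context: Fix integers $N>n\ge2$ and real parameters $a_1,\ldots,a_n>0$, $b>0$. For $\boldsymbol x=(x_1,\ldots,x_n)$, $|x|=\sum_{i=1}^nx_i$; $\boldsymbol e_j$ is the $j$-th unit vector. The operators act on real polynomials $p(\boldsymbol x)$ in $x_1,\ldots,x_n$ of total degree $\le N$ by $$\widetilde{\mathcal H}_0p(\boldsymbol x)=\sum_{j=1}^n\Bigl((N-|x|)(x_j+a_j)\bigl(p(\boldsymbol x)-p(\boldsymbol x+\boldsymbol e_j)\bigr)+x_j(N-|x|+b)\bigl(p(\boldsymbol x)-p(\boldsymbol x-\boldsymbol e_j)\bigr)\Bigr),$$ $$\widetilde{\mathcal H}_ip(\boldsymbol x)=\sum_{\substack{i\le j,k\le n\\ j\ne k}}x_j(x_k+a_k)\bigl(p(\boldsymbol x)-p(\boldsymbol x-\boldsymbol e_j+\boldsymbol e_k)\bigr),\quad i=1,\ldots,n-1,$$ and $\widetilde{\mathcal H}_T=\widetilde{\mathcal H}_0+\widetilde{\mathcal H}_1$. *)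

theory Defs
  imports Complex_Main
begin

(* A point (x_1, ..., x_n) is a function x :: nat => real of which only the components
   x 1, ..., x n matter. *)

definition vec_sum :: "nat \<Rightarrow> (nat \<Rightarrow> real) \<Rightarrow> real" where
  "vec_sum n x = (\<Sum>i=1..n. x i)"

definition basis_vec :: "nat \<Rightarrow> nat \<Rightarrow> real" where
  "basis_vec j = (\<lambda>i. if i = j then 1 else 0)"

definition multi_indices :: "nat \<Rightarrow> nat \<Rightarrow> (nat \<Rightarrow> nat) set" where
  "multi_indices n d = {\<alpha>. (\<forall>i. i \<notin> {1..n} \<longrightarrow> \<alpha> i = 0) \<and> (\<Sum>i=1..n. \<alpha> i) \<le> d}"

lemma finite_multi_indices: "finite (multi_indices n d)"
proof (rule finite_subset)
  show "multi_indices n d \<subseteq> {f. \<forall>i. (i \<in> {1..n} \<longrightarrow> f i \<in> {..d}) \<and> (i \<notin> {1..n} \<longrightarrow> f i = 0)}"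
    unfolding multi_indices_def
    by (auto intro: order_trans[OF member_le_sum[of _ "{1..n}"]])
  show "finite {f :: nat \<Rightarrow> nat. \<forall>i. (i \<in> {1..n} \<longrightarrow> f i \<in> {..d}) \<and> (i \<notin> {1..n} \<longrightarrow> f i = 0)}"
    by (rule finite_set_of_finite_funs) auto
qed

(* Real polynomials in x_1, ..., x_n of total degree at most d, identified with the
   functions they induce (faithful because the reals are an infinite field). *)
definition polys_upto :: "nat \<Rightarrow> nat \<Rightarrow> ((nat \<Rightarrow> real) \<Rightarrow> real) set" where
  "polys_upto n d =
     {p. \<exists>c :: (nat \<Rightarrow> nat) \<Rightarrow> real.
           p = (\<lambda>x. \<Sum>\<alpha>\<in>multi_indices n d. c \<alpha> * (\<Prod>i=1..n. x i ^ \<alpha> i))}"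

definition H_zero ::
  "nat \<Rightarrow> nat \<Rightarrow> (nat \<Rightarrow> real) \<Rightarrow> real \<Rightarrow> ((nat \<Rightarrow> real) \<Rightarrow> real) \<Rightarrow> (nat \<Rightarrow> real) \<Rightarrow> real" where
  "H_zero N n a b p x =
     (\<Sum>j=1..n.
        (real N - vec_sum n x) * (x j + a j) * (p x - p (\<lambda>l. x l + basis_vec j l))
        + x j * (real N - vec_sum n x + b) * (p x - p (\<lambda>l. x l - basis_vec j l)))"

definition H_pos ::
  "nat \<Rightarrow> (nat \<Rightarrow> real) \<Rightarrow> nat \<Rightarrow> ((nat \<Rightarrow> real) \<Rightarrow> real) \<Rightarrow> (nat \<Rightarrow> real) \<Rightarrow> real" where
  "H_pos n a i p x =
     (\<Sum>(j, k)\<in>{(j, k). j \<in> {i..n} \<and> k \<in> {i..n} \<and> j \<noteq> k}.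
        x j * (x k + a k) * (p x - p (\<lambda>l. x l - basis_vec j l + basis_vec k l)))"

definition H_op ::
  "nat \<Rightarrow> nat \<Rightarrow> (nat \<Rightarrow> real) \<Rightarrow> real \<Rightarrow> nat \<Rightarrow> ((nat \<Rightarrow> real) \<Rightarrow> real) \<Rightarrow> (nat \<Rightarrow> real) \<Rightarrow> real" where
  "H_op N n a b i = (if i = 0 then H_zero N n a b else H_pos n a i)"

definition H_total ::
  "nat \<Rightarrow> nat \<Rightarrow> (nat \<Rightarrow> real) \<Rightarrow> real \<Rightarrow> ((nat \<Rightarrow> real) \<Rightarrow> real) \<Rightarrow> (nat \<Rightarrow> real) \<Rightarrow> real" where
  "H_total N n a b p x = H_op N n a b 0 p x + H_op N n a b 1 p x"

definition commutator ::
  "(('c \<Rightarrow> real) \<Rightarrow> 'c \<Rightarrow> real) \<Rightarrow> (('c \<Rightarrow> real) \<Rightarrow> 'c \<Rightarrow> real) \<Rightarrow> ('c \<Rightarrow> real) \<Rightarrow> 'c \<Rightarrow> real" where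
  "commutator A B p x = A (B p) x - B (A p) x"

end

theory Submission
  imports Defs "HOL-Library.Function_Algebras"
begin

text \<open>
  The idea is to treat the slack \<open>x\<^sub>0 = N - |x|\<close> as one more coordinate, with parameter
  \<open>a\<^sub>0 = b\<close>. Think of \<open>x\<^sub>j\<close> as the number of particles at site \<open>j\<close>, for \<open>j = 0, ..., n\<close>; the total
  number is \<open>N\<close>. All terms in the operators then have one and the same shape: one particle hops from
  a site \<open>j\<close> to a site \<open>k\<close>, with rate \<open>x\<^sub>j (x\<^sub>k + a\<^sub>k)\<close>. Writing \<open>C(S)\<close> for the sum of these hopping
  operators over all ordered pairs of sites in \<open>S\<close>, one finds \<open>H\<^sub>i = C({i..n})\<close> for \<open>i \<ge> 1\<close>,
  \<open>H\<^sub>T = C({0..n})\<close> and hence \<open>H\<^sub>0 = C({0..n}) - C({1..n})\<close>. Since the sets \<open>{i..n}\<close> are nested, it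
  suffices that \<open>C(S)\<close> and \<open>C(T)\<close> commute whenever \<open>S \<subseteq> T\<close>.

  This in turn comes from two relations for the symmetrised operators \<open>C\<^sub>j\<^sub>k\<close> (a hop in either
  direction between \<open>j\<close> and \<open>k\<close>), which are the Kohno-Drinfeld relations:
  \<open>[C\<^sub>j\<^sub>k, C\<^sub>l\<^sub>m] = 0\<close> if the pairs are disjoint, and \<open>[C\<^sub>j\<^sub>k, C\<^sub>j\<^sub>l + C\<^sub>k\<^sub>l] = 0\<close> for distinct \<open>j, k, l\<close>.
  Both are finite computations: compare the coefficients of the values of the function at the
  points that two hops can reach. They make every \<open>C\<^sub>j\<^sub>k\<close> with \<open>j, k \<in> T\<close> commute with \<open>C(T)\<close>, and \<open>C(S)\<close>
  is a sum of such \<open>C\<^sub>j\<^sub>k\<close>.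
\<close>

section \<open>Commutators as additive maps\<close>

text \<open>Operators form an additive group under pointwise addition, so a commutator of sums of
  operators can be expanded once the commutator is known to be additive. In its second argument
  this needs additivity of the first operator only; swapping the arguments gives the other side.\<close>

lemma sum_fun_apply: "(\<Sum>i\<in>I. F i) x = (\<Sum>i\<in>I. F i x)" for F :: "'a \<Rightarrow> 'b \<Rightarrow> 'c::comm_monoid_add"
  by (induction I rule: infinite_finite_induct) simp_all

lemma commutator_eq: "commutator A B = (\<lambda>p. A (B p) - B (A p))"
  by (intro ext) (simp add: commutator_def)

lemma commutator_self: "commutator A A = 0"
  by (simp add: commutator_eq fun_eq_iff)

lemma commutator_swap: "commutator A B = - commutator B A"
  by (simp add: commutator_eq fun_eq_iff)

lemma commutator_eq_0_swap: "commutator A B = 0 \<Longrightarrow> commutator B A = 0"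
  using commutator_swap[of B A] by simp

lemma additive_commutator: "additive A \<Longrightarrow> additive (commutator A)"
  by (auto simp: additive_def commutator_eq fun_eq_iff)

lemma additive_fun_add: "additive A \<Longrightarrow> additive B \<Longrightarrow> additive (A + B)"
  by (simp add: additive_def algebra_simps)

lemma additive_fun_sum:
  "(\<And>i. i \<in> I \<Longrightarrow> additive (F i)) \<Longrightarrow> additive (\<Sum>i\<in>I. F i)"
  by (induction I rule: infinite_finite_induct)
     (simp_all add: additive_fun_add, simp_all add: additive_def)

section \<open>Hopping operators\<close>

text \<open>An abstract configuration space for particles on the sites \<open>V\<close>: \<open>y l x\<close> is the number of
  particles at site \<open>l\<close> in the configuration \<open>x\<close>. Only the effect of the differences
  \<open>e k - e j\<close> on \<open>y\<close> is prescribed, not that of the individual \<open>e j\<close>: this leaves room for a site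
  whose number is determined by the others and whose \<open>e j\<close> is zero.\<close>

locale hopping =
  fixes V :: "'i set" and y :: "'i \<Rightarrow> 'c::ab_group_add \<Rightarrow> real" and e :: "'i \<Rightarrow> 'c"
    and a :: "'i \<Rightarrow> real"
  assumes finite_V: "finite V"
    and y_move: "\<lbrakk>j \<in> V; k \<in> V; l \<in> V\<rbrakk> \<Longrightarrow>
      y l (x - e j + e k) = y l x - of_bool (l = j) + of_bool (l = k)"
begin

definition move :: "'i \<Rightarrow> 'i \<Rightarrow> 'c \<Rightarrow> 'c" where
  "move j k x = x - e j + e k"

definition hop :: "'i \<Rightarrow> 'i \<Rightarrow> ('c \<Rightarrow> real) \<Rightarrow> 'c \<Rightarrow> real" where
  "hop j k p x = y j x * (y k x + a k) * (p x - p (move j k x))"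

text \<open>The name comes from \<open>su(1,1)\<close>: up to sign, an additive constant and the choice of a basis,
  this is how its Casimir element acts on the tensor product of the two lowest-weight
  representations that belong to the sites \<open>j\<close> and \<open>k\<close>.\<close>

definition casimir :: "'i \<Rightarrow> 'i \<Rightarrow> ('c \<Rightarrow> real) \<Rightarrow> 'c \<Rightarrow> real" where
  "casimir j k = hop j k + hop k j"

text \<open>The diagonal terms vanish, so this equals the sum over the pairs of distinct sites; a full
  square as index set lets the double sums split and swap freely.\<close>

definition total :: "'i set \<Rightarrow> ('c \<Rightarrow> real) \<Rightarrow> 'c \<Rightarrow> real" where
  "total S = (\<Sum>j\<in>S. \<Sum>k\<in>S. hop j k)"

lemma y_move':
  "\<lbrakk>j \<in> V; k \<in> V; l \<in> V\<rbrakk> \<Longrightarrow> y l (move j k x) = y l x - of_bool (l = j) + of_bool (l = k)"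
  by (simp add: move_def y_move)

lemma move_commute: "move j k (move l m x) = move l m (move j k x)"
  by (simp add: move_def algebra_simps)

text \<open>Together with commutation, these rules bring all compositions of two moves that occur in the
  braid relation to a normal form, so that values of the function at equal points are
  recognised as equal.\<close>

lemma move_collapse:
  "move j k (move k l x) = move j l x" "move k l (move j k x) = move j l x" "move j j x = x"
  by (simp_all add: move_def algebra_simps)

lemma additive_hop: "additive (hop j k)"
  by (simp add: additive_def hop_def fun_eq_iff algebra_simps)

lemma hop_self: "hop j j = 0"
  by (simp add: hop_def fun_eq_iff move_collapse)

lemma additive_casimir: "additive (casimir j k)"
  by (simp add: casimir_def additive_fun_add additive_hop)

lemma additive_total: "additive (total S)"
  by (simp add: total_def additive_fun_sum additive_hop)

lemma casimir_commute: "casimir j k = casimir k j"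
  by (simp add: casimir_def add.commute)

lemma casimir_self: "casimir j j = 0"
  by (simp add: casimir_def hop_self)

text \<open>Doubling is the price for symmetry: each \<open>casimir j k\<close> with \<open>j \<noteq> k\<close> occurs twice on the right.\<close>

lemma double_total: "total S + total S = (\<Sum>j\<in>S. \<Sum>k\<in>S. casimir j k)"
proof -
  have "total S = (\<Sum>j\<in>S. \<Sum>k\<in>S. hop k j)"
    unfolding total_def by (rule sum.swap)
  then show ?thesis
    by (simp add: casimir_def sum.distrib total_def)
qed

text \<open>The rates of one operator are unchanged by the hops of the other, and the hops commute.\<close>

lemma commutator_casimir_disjoint:
  assumes "j \<in> V" "k \<in> V" "l \<in> V" "m \<in> V" "l \<noteq> j" "l \<noteq> k" "m \<noteq> j" "m \<noteq> k"
  shows "commutator (casimir j k) (casimir l m) = 0"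
proof (intro ext)
  fix p x
  show "commutator (casimir j k) (casimir l m) p x = 0 p x"
    unfolding commutator_def casimir_def hop_def plus_fun_apply
    using assms assms(5-8)[THEN not_sym]
    by (simp add: y_move' move_commute[of l m] move_commute[of m l]) (simp add: algebra_simps)
qed

text \<open>Neither of the two summands commutes with \<open>casimir j k\<close> by itself in general. A hop between \<open>j\<close> and \<open>l\<close>
  can be composed from hops through \<open>k\<close>, and the cancellation takes place among these different
  routes. Once the moves are normalised, it is an identity of polynomials in the occupation
  numbers, the parameters and the values of the function.\<close>

lemma commutator_casimir_braid:
  assumes "j \<in> V" "k \<in> V" "l \<in> V" "j \<noteq> k" "l \<noteq> j" "l \<noteq> k"
  shows "commutator (casimir j k) (casimir j l + casimir k l) = 0"
proof (intro ext)
  fix p x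
  show "commutator (casimir j k) (casimir j l + casimir k l) p x = 0 p x"
    unfolding commutator_def casimir_def hop_def plus_fun_apply
    using assms assms(4-6)[THEN not_sym]
    by (simp add: y_move' move_collapse move_commute[of j l] move_commute[of l j]
          move_commute[of k l] move_commute[of l k]) (simp add: algebra_simps)
qed

text \<open>Expand the total over pairs \<open>{l, m}\<close>. Pairs disjoint from \<open>{j, k}\<close> and the pair \<open>{j, k}\<close> itself
  contribute nothing, and the pairs meeting \<open>{j, k}\<close> in one element group into braid relations,
  one for each site outside \<open>{j, k}\<close>.\<close>

lemma commutator_casimir_total:
  assumes T: "T \<subseteq> V" and jk: "j \<in> T" "k \<in> T"
  shows "commutator (casimir j k) (total T) = 0"
proof (cases "j = k")
  case True
  then show ?thesis
    by (simp add: casimir_self commutator_eq fun_eq_iff additive.zero[OF additive_total])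
next
  case False
  interpret additive "commutator (casimir j k)"
    by (intro additive_commutator additive_casimir)
  define A where "A l m = commutator (casimir j k) (casimir l m)" for l m
  have A_sym: "A l m = A m l" for l m
    by (simp add: A_def casimir_commute)
  have braid: "A j m + A k m = 0" if "m \<in> T" for m
  proof (cases "m = j \<or> m = k")
    case True
    then show ?thesis
      by (auto simp: A_def casimir_self zero commutator_self casimir_commute[of k j])
  next
    case False
    then show ?thesis
      unfolding A_def add[symmetric] using T jk that \<open>j \<noteq> k\<close>
      by (intro commutator_casimir_braid) auto
  qed
  have fin: "finite T"
    using T finite_V finite_subset by blast
  have split: "sum f T = f j + f k + sum f (T - {j, k})" for f :: "'i \<Rightarrow> ('c \<Rightarrow> real) \<Rightarrow> 'c \<Rightarrow> real"
    using fin jk False sum.subset_diff[of "{j, k}" T f] by (simp add: add.commute)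
  \<comment> \<open>By symmetry, the two terms of the row of \<open>l\<close> in the columns \<open>j\<close> and \<open>k\<close> form a braid relation.\<close>
  have rest: "(\<Sum>m\<in>T. A l m) = 0" if "l \<in> T - {j, k}" for l
  proof -
    have "(\<Sum>m\<in>T. A l m) = (A j l + A k l) + (\<Sum>m\<in>T - {j, k}. A l m)"
      by (simp add: split A_sym)
    also have "(\<Sum>m\<in>T - {j, k}. A l m) = 0"
      unfolding A_def using that T jk by (intro sum.neutral ballI commutator_casimir_disjoint) auto
    finally show ?thesis
      using that braid[of l] by (simp only: add_0_right) blast
  qed
  have "commutator (casimir j k) (total T) + commutator (casimir j k) (total T)
      = (\<Sum>l\<in>T. \<Sum>m\<in>T. A l m)"
    by (simp add: add[symmetric] double_total sum A_def)
  also have "\<dots> = (\<Sum>m\<in>T. A j m + A k m) + (\<Sum>l\<in>T - {j, k}. \<Sum>m\<in>T. A l m)"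
    by (simp add: split[of "\<lambda>l. \<Sum>m\<in>T. A l m"] sum.distrib)
  also have "\<dots> = 0"
    by (simp add: braid rest)
  finally show ?thesis
    by (simp add: fun_eq_iff)
qed

lemma commutator_total_subset:
  assumes "S \<subseteq> T" "T \<subseteq> V"
  shows "commutator (total T) (total S) = 0"
proof -
  interpret additive "commutator (total T)"
    by (intro additive_commutator additive_total)
  have "commutator (total T) (total S) + commutator (total T) (total S)
      = (\<Sum>j\<in>S. \<Sum>k\<in>S. commutator (total T) (casimir j k))"
    by (simp add: add[symmetric] double_total sum)
  also have "\<dots> = 0"
    using assms commutator_casimir_total commutator_eq_0_swap
    by (intro sum.neutral ballI) blast
  finally show ?thesis
    by (simp add: fun_eq_iff)
qed

end

section \<open>The slack variable as an additional site\<close>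

text \<open>Site \<open>0\<close> holds the particles that are missing to the total \<open>N\<close>. Moving a particle there just
  removes it from its old site, so its vector is zero.\<close>


definition occupation :: "nat \<Rightarrow> nat \<Rightarrow> nat \<Rightarrow> (nat \<Rightarrow> real) \<Rightarrow> real" where
  "occupation N n l x = (if l = 0 then real N - vec_sum n x else x l)"

definition site_vec :: "nat \<Rightarrow> nat \<Rightarrow> real" where
  "site_vec j = (if j = 0 then 0 else basis_vec j)"

lemma vec_sum_site_vec: "j \<in> {0..n} \<Longrightarrow> vec_sum n (site_vec j) = of_bool (j \<noteq> 0)"
  by (auto simp: vec_sum_def site_vec_def basis_vec_def)

interpretation sites: hopping "{0..n}" "occupation N n" site_vec "a(0 := b)" for N n a b
proof
  fix j k l :: nat and x :: "nat \<Rightarrow> real"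
  assume V: "j \<in> {0..n}" "k \<in> {0..n}" "l \<in> {0..n}"
  have "vec_sum n (x - site_vec j + site_vec k)
      = vec_sum n x - vec_sum n (site_vec j) + vec_sum n (site_vec k)"
    by (simp add: vec_sum_def sum.distrib sum_subtractf)
  then show "occupation N n l (x - site_vec j + site_vec k)
      = occupation N n l x - of_bool (l = j) + of_bool (l = k)"
    using V by (cases "l = 0") (auto simp: occupation_def vec_sum_site_vec, auto simp: site_vec_def basis_vec_def)
qed auto

abbreviation total_from ::
  "nat \<Rightarrow> nat \<Rightarrow> (nat \<Rightarrow> real) \<Rightarrow> real \<Rightarrow> nat \<Rightarrow> ((nat \<Rightarrow> real) \<Rightarrow> real) \<Rightarrow> (nat \<Rightarrow> real) \<Rightarrow> real" where
  "total_from N n a b i \<equiv> sites.total N n a b {i..n}"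

lemma H_pos_eq_total:
  assumes "i \<ge> 1"
  shows "H_pos n a i = total_from N n a b i"
proof (intro ext)
  fix p x
  let ?h = "\<lambda>(j, k). sites.hop N n a b j k p x"
  have "H_pos n a i p x = sum ?h {(j, k). j \<in> {i..n} \<and> k \<in> {i..n} \<and> j \<noteq> k}"
    unfolding H_pos_def
  proof (intro sum.cong refl, clarify)
    fix j k assume "j \<in> {i..n}" "k \<in> {i..n}"
    moreover have "(\<lambda>l. x l - basis_vec j l + basis_vec k l) = x - basis_vec j + basis_vec k"
      by (simp add: fun_eq_iff)
    ultimately show "x j * (x k + a k) * (p x - p (\<lambda>l. x l - basis_vec j l + basis_vec k l)) =
        sites.hop N n a b j k p x"
      using assms by (simp add: sites.hop_def sites.move_def occupation_def site_vec_def)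
  qed
  also have "\<dots> = sum ?h ({i..n} \<times> {i..n})"
    by (intro sum.mono_neutral_left) (auto simp: sites.hop_self)
  also have "\<dots> = total_from N n a b i p x"
    by (simp add: sites.total_def sum_fun_apply sum.cartesian_product[symmetric])
  finally show "H_pos n a i p x = total_from N n a b i p x" .
qed

lemma H_zero_eq_total:
  "H_zero N n a b = total_from N n a b 0 - total_from N n a b 1"
proof (intro ext)
  fix p x
  let ?h = "\<lambda>j k. sites.hop N n a b j k p x"
  have "{0..n} = insert 0 {1..n}"
    by auto
  then have "total_from N n a b 0 p x
      = (\<Sum>j=1..n. ?h 0 j + ?h j 0) + total_from N n a b 1 p x"
    by (simp add: sites.total_def sum_fun_apply sum.distrib sites.hop_self)
  moreover have "(\<Sum>j=1..n. ?h 0 j + ?h j 0) = H_zero N n a b p x"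
    unfolding H_zero_def
  proof (intro sum.cong refl)
    fix j assume j: "j \<in> {1..n}"
    have "(\<lambda>l. x l + basis_vec j l) = x + basis_vec j" "(\<lambda>l. x l - basis_vec j l) = x - basis_vec j"
      by (simp_all add: fun_eq_iff)
    then show "?h 0 j + ?h j 0 =
        (real N - vec_sum n x) * (x j + a j) * (p x - p (\<lambda>l. x l + basis_vec j l))
        + x j * (real N - vec_sum n x + b) * (p x - p (\<lambda>l. x l - basis_vec j l))"
      using j by (simp add: sites.hop_def sites.move_def occupation_def site_vec_def)
  qed
  ultimately show "H_zero N n a b p x = (total_from N n a b 0 - total_from N n a b 1) p x"
    by simp
qed

lemma H_op_eq_total:
  "H_op N n a b i =
    (if i = 0 then total_from N n a b 0 - total_from N n a b 1 else total_from N n a b i)"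
  by (simp add: H_op_def H_zero_eq_total H_pos_eq_total)

lemma H_total_eq_total: "H_total N n a b = total_from N n a b 0"
  by (intro ext) (simp add: H_total_def H_op_eq_total)

section \<open>Commutativity\<close>

lemma additive_H_op: "additive (H_op N n a b i)"
proof -
  have "additive (total_from N n a b j)" for j
    by (rule sites.additive_total)
  then show ?thesis
    by (simp add: H_op_eq_total additive_def algebra_simps)
qed

lemma commutator_total_from: "commutator (total_from N n a b i) (total_from N n a b j) = 0"
proof (cases "i \<le> j")
  case True
  then show ?thesis
    by (intro sites.commutator_total_subset) auto
next
  case False
  then show ?thesis
    by (intro commutator_eq_0_swap[OF sites.commutator_total_subset]) auto
qed

lemma commutator_total_from_H_op: "commutator (total_from N n a b i) (H_op N n a b j) = 0"
proof -
  interpret additive "commutator (total_from N n a b i)"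
    by (intro additive_commutator sites.additive_total)
  show ?thesis
    by (simp add: H_op_eq_total diff commutator_total_from)
qed

lemma commutator_H_op: "commutator (H_op N n a b j) (H_op N n a b k) = 0"
proof -
  interpret additive "commutator (H_op N n a b j)"
    by (intro additive_commutator additive_H_op)
  have "commutator (H_op N n a b j) (total_from N n a b i) = 0" for i
    by (rule commutator_eq_0_swap[OF commutator_total_from_H_op])
  then show ?thesis
    by (simp add: H_op_eq_total[of _ _ _ _ k] diff)
qed

theorem proposition2p5:
  fixes N n :: nat and a :: "nat \<Rightarrow> real" and b :: real
  assumes "n \<ge> 2" and "N > n"
    and "\<And>i. i \<in> {1..n} \<Longrightarrow> a i > 0" and "b > 0"
  shows "(\<forall>j\<in>{0..n - 1}. \<forall>p\<in>polys_upto n N.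
            commutator (H_total N n a b) (H_op N n a b j) p = (\<lambda>x. 0))
       \<and> (\<forall>j\<in>{0..n - 1}. \<forall>k\<in>{0..n - 1}. \<forall>p\<in>polys_upto n N.
            commutator (H_op N n a b j) (H_op N n a b k) p = (\<lambda>x. 0))"
  by (simp add: H_total_eq_total commutator_total_from_H_op commutator_H_op zero_fun_def)

end
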